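(* Let $(M,\mathcal B,\mu,\Phi_t)$ with vector field $v=\psi w$ and $(M,\mathcal B,\nu,\Psi_t)$ with vector field $w$ be ergodic systems related by the smooth time-change function $\psi$, as described in the context. Assume that the generator $\tilde w$ has pure point spectrum with eigenfrequencies $\{\omega_k\}$ and corresponding orthonormal eigenfunctions $\{z_k\}$ on $L^2(M,\nu)$, i.e. $\tilde w z_k=\mathrm i\omega_kz_k$. Then, under evolution by the Koopman group $\{U_t\}_{t\in\mathbb R}$ on $L^2(M,\mu)$, $U_tf=f\circ\Phi_t$, the following hold: (i) The $z_k$ evolve according to $$\frac{d}{dt}U_tz_k=\mathrm i\omega_k\,T_{\psi_t}U_tz_k,$$ where $T_{\psi_t}$ is the bounded multiplication operator on $L^2(M,\mu)$ by $\psi_t=\psi\circ\Phi_t$. (ii) For $\mu$-a.e. $a\in M$, the time series $t\mapsto\tilde z_k(t)=z_k(\Phi_t(a))$ evolves as a nonautonomous, variable-frequency harmonic oscillator, $$\frac{d\tilde z_k(t)}{dt}=\mathrm i\omega_k\tilde\psi(t)\tilde z_k(t),\qquad \tilde\psi(t)=\psi_t(a),\qquad \tilde z_k(t)=e^{\mathrm i\omega_k\int_0^t\tilde\psi(t')\,dt'}\,\tilde z_k(0).$$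
   Context: $M$ is a closed, connected, compact, orientable $C^\infty$ manifold with Borel $\sigma$-algebra $\mathcal B$. $\Psi_t$ is a smooth flow on $M$ with smooth vector field $w$, ergodic for an invariant Borel probability measure $\nu$ with smooth positive density in local coordinates. $\psi\in C^\infty(M)$ is positive and bounded away from zero; $v=\psi w$ is a smooth vector field with flow $\Phi_t$, which is ergodic for the invariant probability measure $\mu$ with $d\mu/d\nu=(1/\psi)/\int_M\psi^{-1}d\nu$. $\tilde v$ and $\tilde w$ are the skew-adjoint generators of the Koopman groups $f\mapsto f\circ\Phi_t$ on $L^2(M,\mu)$ and $f\mapsto f\circ\Psi_t$ on $L^2(M,\nu)$. $L^2(M,\mu)$ and $L^2(M,\nu)$ (and likewise the domains $D(\tilde v)$, $D(\tilde w)$) are canonically identified, and $\tilde v=T_\psi\circ\tilde w$, where $T_\psi$ is multiplication by $\psi$. Pure point spectrum means that $L^2(M,\nu)$ has an orthonormal basis of eigenfunctions of $\tilde w$. The standing assumption is that these eigenfunctions $z_k$ are smooth. The time derivative in (i) is in the $L^2(M,\mu)$ norm. *)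

theory Defs
  imports "HOL-Probability.Probability"
begin

text \<open>Only used on open sets, where \<^const>\<open>frechet_derivative\<close> is determined by the values of the
  map on the set.\<close>

primrec times_differentiable_on ::
  "nat \<Rightarrow> 'a::euclidean_space set \<Rightarrow> ('a \<Rightarrow> 'b::euclidean_space) \<Rightarrow> bool" where
  "times_differentiable_on 0 S f \<longleftrightarrow> continuous_on S f"
| "times_differentiable_on (Suc n) S f \<longleftrightarrow>
     (\<forall>x\<in>S. f differentiable (at x)) \<and>
     (\<forall>v. times_differentiable_on n S (\<lambda>x. frechet_derivative f (at x) v))"

definition smooth_on ::
  "'a::euclidean_space set \<Rightarrow> ('a \<Rightarrow> 'b::euclidean_space) \<Rightarrow> bool" where
  "smooth_on S f \<longleftrightarrow> (\<forall>n. times_differentiable_on n S f)"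

text \<open>The manifold is a whole type. A chart is a coordinate domain \<open>U\<close> together with a coordinate
  map \<open>\<phi>\<close>, of which only the values on \<open>U\<close> matter.\<close>

type_synonym ('m, 'n) chart = "'m set \<times> ('m \<Rightarrow> real ^ 'n)"

definition smooth_atlas ::
  "('m::{t2_space,second_countable_topology}, 'n::finite) chart set \<Rightarrow> bool" where
  "smooth_atlas A \<longleftrightarrow>
     (\<forall>(U, \<phi>)\<in>A. open U \<and> open (\<phi> ` U) \<and> homeomorphism U (\<phi> ` U) \<phi> (inv_into U \<phi>)) \<and>
     (\<Union>(U, \<phi>)\<in>A. U) = UNIV \<and>
     (\<forall>(U, \<phi>)\<in>A. \<forall>(V, \<eta>)\<in>A. smooth_on (\<phi> ` (U \<inter> V)) (\<eta> \<circ> inv_into U \<phi>))"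

definition oriented_atlas ::
  "('m::{t2_space,second_countable_topology}, 'n::finite) chart set \<Rightarrow> bool" where
  "oriented_atlas A \<longleftrightarrow> smooth_atlas A \<and>
     (\<forall>(U, \<phi>)\<in>A. \<forall>(V, \<eta>)\<in>A. \<forall>y\<in>\<phi> ` (U \<inter> V).
        det (matrix (frechet_derivative (\<eta> \<circ> inv_into U \<phi>) (at y))) > 0)"

text \<open>The union being an atlas means that \<open>A\<close> and \<open>B\<close> define the same smooth structure.\<close>

definition orientable ::
  "('m::{t2_space,second_countable_topology}, 'n::finite) chart set \<Rightarrow> bool" where
  "orientable A \<longleftrightarrow> (\<exists>B. oriented_atlas B \<and> smooth_atlas (A \<union> B))"

definition smooth_fun ::
  "('m::{t2_space,second_countable_topology}, 'n::finite) chart set \<Rightarrow>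
   ('m \<Rightarrow> 'b::euclidean_space) \<Rightarrow> bool" where
  "smooth_fun A f \<longleftrightarrow> (\<forall>(U, \<phi>)\<in>A. smooth_on (\<phi> ` U) (f \<circ> inv_into U \<phi>))"

text \<open>Vector fields are derivations of the algebra of real smooth functions. Values of \<open>w\<close> on
  functions that are not smooth are irrelevant.\<close>

definition smooth_vector_field ::
  "('m::{t2_space,second_countable_topology}, 'n::finite) chart set \<Rightarrow>
   (('m \<Rightarrow> real) \<Rightarrow> 'm \<Rightarrow> real) \<Rightarrow> bool" where
  "smooth_vector_field A w \<longleftrightarrow>
     (\<forall>f. smooth_fun A f \<longrightarrow> smooth_fun A (w f)) \<and>
     (\<forall>f g. smooth_fun A f \<longrightarrow> smooth_fun A g \<longrightarrow>
        (\<forall>a b. w (\<lambda>x. a * f x + b * g x) = (\<lambda>x. a * w f x + b * w g x)) \<and>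
        w (\<lambda>x. f x * g x) = (\<lambda>x. f x * w g x + w f x * g x))"

definition scale_field ::
  "('m \<Rightarrow> real) \<Rightarrow> (('m \<Rightarrow> real) \<Rightarrow> 'm \<Rightarrow> real) \<Rightarrow> ('m \<Rightarrow> real) \<Rightarrow> 'm \<Rightarrow> real" where
  "scale_field \<psi> w = (\<lambda>f x. \<psi> x * w f x)"

text \<open>By continuity, the sets on which local representatives of the flow are required to be smooth
  are open in \<open>\<real> \<times> \<real>\<^sup>n\<close>.\<close>

definition smooth_flow ::
  "('m::{t2_space,second_countable_topology}, 'n::finite) chart set \<Rightarrow>
   (real \<Rightarrow> 'm \<Rightarrow> 'm) \<Rightarrow> bool" where
  "smooth_flow A F \<longleftrightarrow>
     (\<forall>x. F 0 x = x) \<and> (\<forall>s t x. F (s + t) x = F s (F t x)) \<and>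
     continuous_on UNIV (\<lambda>(t, x). F t x) \<and>
     (\<forall>(U, \<phi>)\<in>A. \<forall>(V, \<eta>)\<in>A.
        smooth_on {(t, y). y \<in> \<phi> ` U \<and> F t (inv_into U \<phi> y) \<in> V}
          (\<lambda>(t, y). \<eta> (F t (inv_into U \<phi> y))))"

definition flow_of_field ::
  "('m::{t2_space,second_countable_topology}, 'n::finite) chart set \<Rightarrow>
   (('m \<Rightarrow> real) \<Rightarrow> 'm \<Rightarrow> real) \<Rightarrow> (real \<Rightarrow> 'm \<Rightarrow> 'm) \<Rightarrow> bool" where
  "flow_of_field A w F \<longleftrightarrow> smooth_flow A F \<and>
     (\<forall>f x t. smooth_fun A f \<longrightarrow> ((\<lambda>s. f (F s x)) has_real_derivative w f (F t x)) (at t))"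

definition smooth_positive_density ::
  "('m::{t2_space,second_countable_topology}, 'n::finite) chart set \<Rightarrow> 'm measure \<Rightarrow> bool" where
  "smooth_positive_density A M \<longleftrightarrow>
     (\<forall>(U, \<phi>)\<in>A. \<exists>\<rho>. smooth_on (\<phi> ` U) \<rho> \<and> (\<forall>y\<in>\<phi> ` U. \<rho> y > 0) \<and>
        (\<forall>B\<in>sets borel. B \<subseteq> U \<longrightarrow>
           emeasure M B = (\<integral>\<^sup>+ y. ennreal (\<rho> y) * indicator (\<phi> ` B) y \<partial>lborel)))"

text \<open>Invariant sets are strictly invariant under all times; for continuous flows this gives the
  same notion as invariance up to null sets for each time.\<close>

definition ergodic_flow ::
  "'m::topological_space measure \<Rightarrow> (real \<Rightarrow> 'm \<Rightarrow> 'm) \<Rightarrow> bool" where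
  "ergodic_flow M F \<longleftrightarrow>
     prob_space M \<and> sets M = sets borel \<and>
     (\<forall>t. F t \<in> measurable M M \<and> distr M M (F t) = M) \<and>
     (\<forall>E\<in>sets M. (\<forall>t. F t -` E = E) \<longrightarrow> measure M E = 0 \<or> measure M E = 1)"

definition time_change_measure :: "('m \<Rightarrow> real) \<Rightarrow> 'm measure \<Rightarrow> 'm measure" where
  "time_change_measure \<psi> M =
     density M (\<lambda>x. ennreal ((1 / \<psi> x) / (\<integral>y. 1 / \<psi> y \<partial>M)))"

text \<open>Elements of the Hilbert space are represented by functions; equality of elements is
  equality almost everywhere, that is, \<open>L2_norm M (f - g) = 0\<close>.\<close>

definition L2 :: "'m measure \<Rightarrow> ('m \<Rightarrow> complex) set" where
  "L2 M = {f \<in> borel_measurable M. integrable M (\<lambda>x. (norm (f x))\<^sup>2)}"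

definition L2_norm :: "'m measure \<Rightarrow> ('m \<Rightarrow> complex) \<Rightarrow> real" where
  "L2_norm M f = sqrt (\<integral>x. (norm (f x))\<^sup>2 \<partial>M)"

definition L2_inner :: "'m measure \<Rightarrow> ('m \<Rightarrow> complex) \<Rightarrow> ('m \<Rightarrow> complex) \<Rightarrow> complex" where
  "L2_inner M f g = (\<integral>x. cnj (f x) * g x \<partial>M)"

definition L2_orthonormal_basis :: "'m measure \<Rightarrow> ('k \<Rightarrow> 'm \<Rightarrow> complex) \<Rightarrow> bool" where
  "L2_orthonormal_basis M z \<longleftrightarrow>
     (\<forall>k. z k \<in> L2 M) \<and>
     (\<forall>j k. L2_inner M (z j) (z k) = (if j = k then 1 else 0)) \<and>
     (\<forall>f\<in>L2 M. \<forall>e>0. \<exists>K c. finite K \<and> L2_norm M (\<lambda>x. f x - (\<Sum>k\<in>K. c k * z k x)) < e)"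

definition L2_bounded_operator ::
  "'m measure \<Rightarrow> (('m \<Rightarrow> complex) \<Rightarrow> 'm \<Rightarrow> complex) \<Rightarrow> bool" where
  "L2_bounded_operator M T \<longleftrightarrow>
     (\<forall>f\<in>L2 M. T f \<in> L2 M) \<and>
     (\<forall>f\<in>L2 M. \<forall>g\<in>L2 M. \<forall>a b.
        AE x in M. T (\<lambda>x. a * f x + b * g x) x = a * T f x + b * T g x) \<and>
     (\<exists>C. \<forall>f\<in>L2 M. L2_norm M (T f) \<le> C * L2_norm M f)"

definition mult_operator ::
  "('m \<Rightarrow> real) \<Rightarrow> ('m \<Rightarrow> complex) \<Rightarrow> 'm \<Rightarrow> complex" where
  "mult_operator g f = (\<lambda>x. of_real (g x) * f x)"

definition has_L2_derivative ::
  "'m measure \<Rightarrow> (real \<Rightarrow> 'm \<Rightarrow> complex) \<Rightarrow> ('m \<Rightarrow> complex) \<Rightarrow> real \<Rightarrow> bool" where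
  "has_L2_derivative M u u' t \<longleftrightarrow>
     (\<forall>s. u s \<in> L2 M) \<and> u' \<in> L2 M \<and>
     ((\<lambda>h. L2_norm M (\<lambda>x. (u (t + h) x - u t x) / of_real h - u' x)) \<longlongrightarrow> 0) (at 0)"

definition koopman :: "(real \<Rightarrow> 'm \<Rightarrow> 'm) \<Rightarrow> real \<Rightarrow> ('m \<Rightarrow> complex) \<Rightarrow> 'm \<Rightarrow> complex" where
  "koopman F t f = f \<circ> F t"

text \<open>The graph of the generator of the Koopman group: \<open>f\<close> is in its domain and is mapped to
  \<open>g\<close>.\<close>

definition koopman_generator ::
  "'m measure \<Rightarrow> (real \<Rightarrow> 'm \<Rightarrow> 'm) \<Rightarrow> ('m \<Rightarrow> complex) \<Rightarrow> ('m \<Rightarrow> complex) \<Rightarrow> bool" where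
  "koopman_generator M F f g \<longleftrightarrow> has_L2_derivative M (\<lambda>t. koopman F t f) g 0"

end

theory Submission
  imports Defs
begin

text \<open>The derivative of \<open>z\<^sub>k\<close> along the flow of \<open>w\<close> is a continuous function, which by dominated
  convergence is also the \<open>L\<^sup>2\<close> derivative and hence equals \<open>\<i>\<omega>\<^sub>k z\<^sub>k\<close> almost everywhere. As \<open>\<nu>\<close> charges
  every nonempty open set, the two agree everywhere. So \<open>z\<^sub>k\<close> has derivative \<open>\<i>\<omega>\<^sub>k \<psi> z\<^sub>k\<close> along every
  orbit of \<open>v\<close>; dominated convergence turns this into (i), and solving the scalar linear equation
  gives (ii).\<close>

section \<open>Smoothness of functions in coordinates\<close>

text \<open>Near a point of the open set \<open>S\<close> the two functions agree, so their
  derivatives at that point are the same linear map. The functions are kept arbitrary in the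
  induction because the successor step passes to their directional derivatives.\<close>

lemma times_differentiable_on_cong:
  assumes "open S" and "\<And>x. x \<in> S \<Longrightarrow> f x = g x" and "times_differentiable_on n S f"
  shows "times_differentiable_on n S g"
  using assms(2,3)
proof (induction n arbitrary: f g)
  case 0
  then show ?case by (simp cong: continuous_on_cong)
next
  case (Suc n)
  have D: "(g has_derivative frechet_derivative f (at x)) (at x)" if "x \<in> S" for x
  proof (rule has_derivative_transform_within_open[OF _ \<open>open S\<close> that])
    show "(f has_derivative frechet_derivative f (at x)) (at x)"
      using Suc.prems(2) that by (simp add: frechet_derivative_works[symmetric])
  qed (use Suc.prems(1) in simp)
  then have eq: "frechet_derivative f (at x) = frechet_derivative g (at x)" if "x \<in> S" for x
    using that by (intro frechet_derivative_at)
  have "times_differentiable_on n S (\<lambda>x. frechet_derivative g (at x) u)" for u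
    by (rule Suc.IH[where f="\<lambda>x. frechet_derivative f (at x) u"]) (use eq Suc.prems(2) in auto)
  with D show ?case by (auto simp: differentiable_def)
qed

text \<open>A bounded linear map commutes with directional derivatives, so each order reduces to the
  previous one. The commutation is available only on \<open>S\<close>, which is why the induction
  step goes through \<open>times_differentiable_on_cong\<close>.\<close>

lemma times_differentiable_on_bounded_linear:
  assumes "bounded_linear L" and "open S" and "times_differentiable_on n S f"
  shows "times_differentiable_on n S (\<lambda>x. L (f x))"
  using assms(3)
proof (induction n arbitrary: f)
  case 0
  then show ?case using assms(1) by (simp add: bounded_linear.continuous_on)
next
  case (Suc n)
  have D: "((\<lambda>x. L (f x)) has_derivative (\<lambda>u. L (frechet_derivative f (at x) u))) (at x)"
    if "x \<in> S" for x
    using Suc.prems that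
    by (auto intro!: bounded_linear.has_derivative[OF assms(1)]
        simp: frechet_derivative_works[symmetric])
  then have "(\<lambda>u. L (frechet_derivative f (at x) u)) = frechet_derivative (\<lambda>x. L (f x)) (at x)"
    if "x \<in> S" for x
    using that by (intro frechet_derivative_at)
  then have eq: "L (frechet_derivative f (at x) u) = frechet_derivative (\<lambda>x. L (f x)) (at x) u"
    if "x \<in> S" for x u
    using that by metis
  have "times_differentiable_on n S (\<lambda>x. frechet_derivative (\<lambda>x. L (f x)) (at x) u)" for u
    by (rule times_differentiable_on_cong[OF \<open>open S\<close> eq Suc.IH]) (use Suc.prems in auto)
  with D show ?case by (auto simp: differentiable_def)
qed

text \<open>Vector fields act on real functions while the eigenfunctions are complex; this serves to
  pass to their real and imaginary parts.\<close>

lemma smooth_fun_bounded_linear: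
  assumes "smooth_atlas A" and "bounded_linear L" and "smooth_fun A f"
  shows "smooth_fun A (\<lambda>x. L (f x))"
  unfolding smooth_fun_def
proof clarify
  fix U \<phi> assume U: "(U, \<phi>) \<in> A"
  then have "open (\<phi> ` U)" using assms(1) by (auto simp: smooth_atlas_def)
  moreover have "smooth_on (\<phi> ` U) (f \<circ> inv_into U \<phi>)"
    using assms(3) U by (auto simp: smooth_fun_def)
  ultimately show "smooth_on (\<phi> ` U) ((\<lambda>x. L (f x)) \<circ> inv_into U \<phi>)"
    by (auto simp: smooth_on_def o_def intro: times_differentiable_on_bounded_linear[OF assms(2)])
qed

lemma smooth_fun_continuous:
  fixes f :: "'m::{t2_space,second_countable_topology} \<Rightarrow> 'b::euclidean_space"
    and A :: "('m, 'n::finite) chart set"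
  assumes "smooth_atlas A" and "smooth_fun A f"
  shows "continuous_on UNIV f"
proof -
  have "continuous_on U f" if "(U, \<phi>) \<in> A" for U \<phi>
  proof -
    have hom: "homeomorphism U (\<phi> ` U) \<phi> (inv_into U \<phi>)"
      using assms(1) that by (auto simp: smooth_atlas_def)
    have "smooth_on (\<phi> ` U) (f \<circ> inv_into U \<phi>)"
      using assms(2) that by (auto simp: smooth_fun_def)
    then have "times_differentiable_on 0 (\<phi> ` U) (f \<circ> inv_into U \<phi>)"
      unfolding smooth_on_def by blast
    then have "continuous_on (\<phi> ` U) (f \<circ> inv_into U \<phi>)" by simp
    then have "continuous_on U ((f \<circ> inv_into U \<phi>) \<circ> \<phi>)"
      by (rule continuous_on_compose[OF homeomorphism_cont1[OF hom]])
    moreover have "((f \<circ> inv_into U \<phi>) \<circ> \<phi>) x = f x" if "x \<in> U" for x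
      using hom that by (simp add: homeomorphism_def)
    ultimately show ?thesis by (rule continuous_on_eq)
  qed
  moreover have "open U" if "(U, \<phi>) \<in> A" for U \<phi>
    using assms(1) that by (auto simp: smooth_atlas_def)
  ultimately have "continuous_on (\<Union>(U, \<phi>)\<in>A. U) f"
    by (intro continuous_on_open_UN) auto
  then show ?thesis
    using assms(1) by (simp add: smooth_atlas_def)
qed

text \<open>Around a point of \<open>S\<close> the coordinate density is strictly positive, so a
  null open piece of \<open>S\<close> would have a nonempty open image that is Lebesgue negligible.
  This is what upgrades almost everywhere equality of continuous functions to equality
  everywhere.\<close>

lemma smooth_positive_density_open_null:
  fixes A :: "('m::{t2_space,second_countable_topology}, 'n::finite) chart set"
  assumes "smooth_atlas A" and "smooth_positive_density A M"
    and "open S" and "emeasure M S = 0" and "sets M = sets borel"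
  shows "S = {}"
proof (rule ccontr)
  assume "S \<noteq> {}"
  then obtain x where "x \<in> S" by auto
  have "x \<in> (\<Union>(U, \<phi>)\<in>A. U)" using assms(1) by (simp add: smooth_atlas_def)
  then obtain U \<phi> where U: "(U, \<phi>) \<in> A" "x \<in> U" by auto
  have hom: "homeomorphism U (\<phi> ` U) \<phi> (inv_into U \<phi>)" and "open U" "open (\<phi> ` U)"
    using assms(1) U by (auto simp: smooth_atlas_def)
  have "\<exists>\<rho>. smooth_on (\<phi> ` U) \<rho> \<and> (\<forall>y\<in>\<phi> ` U. \<rho> y > 0) \<and>
      (\<forall>B\<in>sets borel. B \<subseteq> U \<longrightarrow>
        emeasure M B = (\<integral>\<^sup>+ y. ennreal (\<rho> y) * indicator (\<phi> ` B) y \<partial>lborel))"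
    using bspec[OF assms(2)[unfolded smooth_positive_density_def] U(1)] by simp
  then obtain \<rho> where \<rho>: "smooth_on (\<phi> ` U) \<rho>" "\<And>y. y \<in> \<phi> ` U \<Longrightarrow> \<rho> y > 0"
    and em: "\<And>B. B \<in> sets borel \<Longrightarrow> B \<subseteq> U \<Longrightarrow>
      emeasure M B = (\<integral>\<^sup>+ y. ennreal (\<rho> y) * indicator (\<phi> ` B) y \<partial>lborel)"
    by metis
  define B where "B = S \<inter> U"
  have B: "open B" "B \<subseteq> U" using \<open>open U\<close> assms(3) by (auto simp: B_def)
  have "openin (top_of_set U) B"
    using B by (simp add: open_subset)
  then have "openin (top_of_set (\<phi> ` U)) (\<phi> ` B)"
    using homeomorphism_imp_open_map[OF hom] by blast
  then have opB: "open (\<phi> ` B)"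
    using \<open>open (\<phi> ` U)\<close> by (simp add: openin_open_eq)
  have "times_differentiable_on 0 (\<phi> ` U) \<rho>"
    using \<rho>(1) unfolding smooth_on_def by blast
  then have "continuous_on (\<phi> ` B) \<rho>"
    using B by (auto intro: continuous_on_subset)
  \<comment> \<open>Nothing is known about \<rho> outside the coordinate image; cutting it off by
    the indicator gives a Borel function on the whole space.\<close>
  then have "(\<lambda>y. indicator (\<phi> ` B) y *\<^sub>R \<rho> y) \<in> borel_measurable borel"
    using opB by (intro borel_measurable_continuous_on_indicator) auto
  then have meas: "(\<lambda>y. ennreal (indicator (\<phi> ` B) y *\<^sub>R \<rho> y)) \<in> borel_measurable lborel"
    by simp
  have eq: "ennreal (\<rho> y) * indicator (\<phi> ` B) y = ennreal (indicator (\<phi> ` B) y *\<^sub>R \<rho> y)" for y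
    by (auto simp: indicator_def)
  have "emeasure M B \<le> emeasure M S"
    using assms by (intro emeasure_mono) (auto simp: B_def)
  then have "emeasure M B = 0" using assms(4) by simp
  then have "(\<integral>\<^sup>+ y. ennreal (indicator (\<phi> ` B) y *\<^sub>R \<rho> y) \<partial>lborel) = 0"
    using em[of B] B by (simp add: eq)
  then have "AE y in lborel. ennreal (indicator (\<phi> ` B) y *\<^sub>R \<rho> y) = 0"
    using nn_integral_0_iff_AE[OF meas] by simp
  then have "AE y in lborel. y \<notin> \<phi> ` B"
  proof (rule AE_mp, intro AE_I2 impI notI)
    fix y assume "ennreal (indicator (\<phi> ` B) y *\<^sub>R \<rho> y) = 0" "y \<in> \<phi> ` B"
    with \<rho>(2)[of y] B show False by (auto simp: ennreal_eq_0_iff)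
  qed
  then have "\<phi> ` B \<in> null_sets lborel"
    using opB by (simp add: AE_iff_null_sets)
  then have "negligible (\<phi> ` B)"
    by (simp add: negligible_iff_null_sets null_sets_completionI)
  moreover have "\<phi> ` B \<noteq> {}" using \<open>x \<in> S\<close> U by (auto simp: B_def)
  ultimately show False
    using opB open_not_negligible by blast
qed

section \<open>Bounded functions, multiplication operators and difference quotients in the Hilbert
  space\<close>

lemma L2_bounded:
  fixes f :: "'m \<Rightarrow> complex"
  assumes "finite_measure M" and "f \<in> borel_measurable M" and "\<And>x. norm (f x) \<le> C"
  shows "f \<in> L2 M"
proof -
  interpret finite_measure M by fact
  have "(norm (f x))\<^sup>2 \<le> C\<^sup>2" for x
    using assms(3)[of x] by (intro power_mono) auto
  then show ?thesis
    using assms(2) by (auto simp: L2_def intro!: integrable_const_bound[where B="C\<^sup>2"])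
qed

lemma L2_bounded_operator_mult:
  assumes "g \<in> borel_measurable M" and "\<And>x. \<bar>g x\<bar> \<le> C"
  shows "L2_bounded_operator M (mult_operator g)"
proof -
  \<comment> \<open>Types are nonempty, so evaluating the bound at any point, here
    \<open>undefined\<close>, shows that \<open>C\<close> is nonnegative.\<close>
  have C: "0 \<le> C" using assms(2)[of undefined] by linarith
  have le: "(norm (mult_operator g f x))\<^sup>2 \<le> C\<^sup>2 * (norm (f x))\<^sup>2" for f x
  proof -
    have "norm (mult_operator g f x) \<le> C * norm (f x)"
      using assms(2)[of x] by (auto simp: mult_operator_def norm_mult intro: mult_right_mono)
    then show ?thesis by (metis norm_ge_zero power_mono power_mult_distrib)
  qed
  have mem: "mult_operator g f \<in> L2 M" if "f \<in> L2 M" for f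
  proof -
    have meas: "mult_operator g f \<in> borel_measurable M"
      using that assms(1) by (auto simp: L2_def mult_operator_def)
    have "integrable M (\<lambda>x. C\<^sup>2 * (norm (f x))\<^sup>2)"
      using that by (auto simp: L2_def)
    then have "integrable M (\<lambda>x. (norm (mult_operator g f x))\<^sup>2)"
      by (rule Bochner_Integration.integrable_bound) (use meas le[of f] C in auto)
    then show ?thesis using meas by (simp add: L2_def)
  qed
  have "L2_norm M (mult_operator g f) \<le> C * L2_norm M f" if "f \<in> L2 M" for f
  proof -
    have "(\<integral>x. (norm (mult_operator g f x))\<^sup>2 \<partial>M) \<le> (\<integral>x. C\<^sup>2 * (norm (f x))\<^sup>2 \<partial>M)"
      using that mem[OF that] le[of f] by (intro integral_mono) (auto simp: L2_def)
    then show ?thesis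
      unfolding L2_norm_def using C
      by (intro real_le_lsqrt) (auto simp: power_mult_distrib)
  qed
  with mem show ?thesis
    unfolding L2_bounded_operator_def
    by (auto simp: mult_operator_def algebra_simps)
qed

text \<open>The mean value inequality bounds the quotients uniformly in \<open>h\<close> and
  \<open>x\<close>, and constants are integrable for a finite measure, so dominated convergence
  applies. The function \<open>g\<close> is left free for two uses: comparing a known norm
  derivative with the pointwise one, and, with \<open>g\<close> the pointwise derivative itself,
  proving that the norm derivative exists.\<close>

lemma L2_norm_difference_quotient_tendsto:
  fixes F :: "real \<Rightarrow> 'm \<Rightarrow> 'm" and f f' g :: "'m \<Rightarrow> complex"
  assumes "finite_measure M" and F: "\<And>t. F t \<in> measurable M M"
    and f: "f \<in> borel_measurable M" and f': "f' \<in> borel_measurable M" "\<And>x. norm (f' x) \<le> C"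
    and g: "g \<in> borel_measurable M" "\<And>x. norm (g x) \<le> D"
    and der: "\<And>x t. ((\<lambda>s. f (F s x)) has_vector_derivative f' (F t x)) (at t)"
  shows "((\<lambda>h. L2_norm M (\<lambda>x. (f (F (t + h) x) - f (F t x)) / of_real h - g x))
    \<longlongrightarrow> L2_norm M (\<lambda>x. f' (F t x) - g x)) (at 0)"
proof -
  interpret finite_measure M by fact
  define q where "q h x = (f (F (t + h) x) - f (F t x)) / of_real h - g x" for h x
  have fF: "(\<lambda>x. f (F s x)) \<in> borel_measurable M" "(\<lambda>x. f' (F s x)) \<in> borel_measurable M" for s
    using measurable_compose[OF F f] measurable_compose[OF F f'(1)] by auto
  have bound: "norm (q h x) \<le> C + D" if "h \<noteq> 0" for h x
  proof -
    have "norm (f (F (t + h) x) - f (F t x)) \<le> C * norm ((t + h) - t)"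
    proof (rule differentiable_bound[where S=UNIV])
      show "((\<lambda>s. f (F s x)) has_derivative (\<lambda>r. r *\<^sub>R f' (F s x))) (at s within UNIV)" for s
        using der[of x s] by (simp add: has_vector_derivative_def)
      show "onorm (\<lambda>r. r *\<^sub>R f' (F s x)) \<le> C" for s
        using f'(2)[of "F s x"]
        by (intro onorm_le) (simp add: mult.commute[of C] mult_left_mono)
    qed auto
    then have "norm ((f (F (t + h) x) - f (F t x)) / of_real h) \<le> C"
      using that by (simp add: norm_divide divide_simps)
    then show ?thesis
      unfolding q_def using g(2)[of x] by (intro order_trans[OF norm_triangle_ineq4]) auto
  qed
  have lim: "((\<lambda>h. q h x) \<longlongrightarrow> f' (F t x) - g x) (at 0)" for x
    unfolding q_def using der[of x t]
    by (intro tendsto_diff tendsto_const)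
      (simp add: tendsto_complex_iff has_vector_derivative_complex_iff DERIV_def)
  have "((\<lambda>h. \<integral>x. (norm (q h x))\<^sup>2 \<partial>M) \<longlongrightarrow> (\<integral>x. (norm (f' (F t x) - g x))\<^sup>2 \<partial>M)) (at 0)"
    \<comment> \<open>Dominated convergence is a statement about sequences, so the limit is tested
      along null sequences; these avoid 0, as \<open>bound\<close> requires.\<close>
    unfolding tendsto_at_iff_sequentially comp_def
  proof (intro allI impI)
    fix X :: "nat \<Rightarrow> real"
    assume X: "\<forall>i. X i \<in> UNIV - {0}" "X \<longlonglongrightarrow> 0"
    show "(\<lambda>n. \<integral>x. (norm (q (X n) x))\<^sup>2 \<partial>M) \<longlonglongrightarrow> (\<integral>x. (norm (f' (F t x) - g x))\<^sup>2 \<partial>M)"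
    proof (rule integral_dominated_convergence[where w="\<lambda>_. (C + D)\<^sup>2"])
      show "AE x in M. (\<lambda>n. (norm (q (X n) x))\<^sup>2) \<longlonglongrightarrow> (norm (f' (F t x) - g x))\<^sup>2"
        using lim X unfolding tendsto_at_iff_sequentially comp_def
        by (intro AE_I2 tendsto_power tendsto_norm) blast
      show "AE x in M. norm ((norm (q (X n) x))\<^sup>2) \<le> (C + D)\<^sup>2" for n
        using X bound[of "X n"] by (auto intro!: AE_I2 power_mono)
    qed (use fF g(1) in \<open>auto simp: q_def\<close>)
  qed
  then show ?thesis
    unfolding L2_norm_def q_def by (intro tendsto_real_sqrt)
qed

section \<open>Differentiation along orbits and the scalar linear equation\<close>

text \<open>The relation between a field and its flow is available for real smooth functions; the
  complex derivative is assembled from the two real components.\<close>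

lemma flow_derivative_complex:
  fixes f :: "'m::{t2_space,second_countable_topology} \<Rightarrow> complex"
    and A :: "('m, 'n::finite) chart set"
  assumes "smooth_atlas A" and "flow_of_field A w F" and "smooth_fun A f"
  shows "((\<lambda>s. f (F s x)) has_vector_derivative
    Complex (w (\<lambda>x. Re (f x)) (F t x)) (w (\<lambda>x. Im (f x)) (F t x))) (at t)"
proof -
  have "smooth_fun A (\<lambda>x. Re (f x))" "smooth_fun A (\<lambda>x. Im (f x))"
    using smooth_fun_bounded_linear[OF assms(1) bounded_linear_Re assms(3)]
      smooth_fun_bounded_linear[OF assms(1) bounded_linear_Im assms(3)] .
  then show ?thesis
    using assms(2)
    by (auto simp: flow_of_field_def has_vector_derivative_complex_iff
        has_real_derivative_iff_has_vector_derivative)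
qed

text \<open>Integrating factor: multiplying \<open>y\<close> by
  \<open>exp (- c * of_real (P t))\<close>, with \<open>P\<close> the primitive of \<open>p\<close>
  vanishing at 0, produces a function of zero derivative.\<close>

lemma exponential_solution:
  fixes y :: "real \<Rightarrow> complex" and p :: "real \<Rightarrow> real"
  assumes p: "continuous_on UNIV p"
    and y: "\<And>t. (y has_vector_derivative c * of_real (p t) * y t) (at t)"
  shows "y t = exp (c * of_real (LBINT s=ereal 0..ereal t. p s)) * y 0"
proof -
  define P where "P t = (LBINT s=ereal 0..ereal t. p s)" for t
  have "(P has_vector_derivative p t) (at t)" for t
  proof -
    \<comment> \<open>The fundamental theorem gives a derivative within a compact interval
      containing 0 and \<open>t\<close>. The margin of 1 puts \<open>t\<close> in the interior, so
      that it is a full derivative.\<close>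
    define a b where "a = min 0 t - 1" and "b = max 0 t + 1"
    have "((\<lambda>u. LBINT s=ereal 0..ereal u. p s) has_vector_derivative p t) (at t within {a..b})"
      by (rule interval_integral_FTC2)
        (auto simp: a_def b_def intro: continuous_on_subset[OF p])
    moreover have "at t within {a..b} = at t"
      by (rule at_within_interior) (auto simp: a_def b_def)
    ultimately show ?thesis by (simp add: P_def[abs_def])
  qed
  then have dP: "((\<lambda>t. of_real (P t) :: complex) has_vector_derivative of_real (p t)) (at t)" for t
    by (intro has_vector_derivative_of_real) (simp add: has_real_derivative_iff_has_vector_derivative)
  have "((\<lambda>t. exp (- c * of_real (P t)) * y t) has_vector_derivative 0) (at t)" for t
  proof -
    have "((\<lambda>t. exp (- c * of_real (P t))) has_vector_derivative
        (- c * of_real (p t)) * exp (- c * of_real (P t))) (at t)"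
      using field_vector_diff_chain_at[OF has_vector_derivative_mult_right[OF dP[of t], of "- c"]
        DERIV_exp] by (simp add: o_def)
    from has_vector_derivative_mult[OF this y[of t]] show ?thesis
      by (simp add: algebra_simps)
  qed
  then obtain k where k: "\<And>t. exp (- c * of_real (P t)) * y t = k"
    using has_derivative_zero_constant[of UNIV "\<lambda>t. exp (- c * of_real (P t)) * y t"]
    by (auto simp: has_vector_derivative_def)
  have "P 0 = 0" by (simp add: P_def)
  then have "exp (- c * of_real (P t)) * y t = y 0"
    using k[of 0] k[of t] by simp
  then show ?thesis
    unfolding P_def[symmetric] by (simp add: exp_minus field_simps)
qed

theorem proposition20:
  fixes A :: "('m::{t2_space,second_countable_topology}, 'n::finite) chart set"
    and w v :: "('m \<Rightarrow> real) \<Rightarrow> 'm \<Rightarrow> real"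
    and \<Psi> \<Phi> :: "real \<Rightarrow> 'm \<Rightarrow> 'm"
    and \<nu> \<mu> :: "'m measure"
    and \<psi> :: "'m \<Rightarrow> real"
    and z :: "'k \<Rightarrow> 'm \<Rightarrow> complex"
    and \<omega> :: "'k \<Rightarrow> real"
  assumes "smooth_atlas A" and "orientable A"
    and "compact (UNIV :: 'm set)" and "connected (UNIV :: 'm set)"
    and "smooth_vector_field A w" and "flow_of_field A w \<Psi>"
    and "ergodic_flow \<nu> \<Psi>" and "smooth_positive_density A \<nu>"
    and "smooth_fun A \<psi>" and "\<exists>c>0. \<forall>x. c \<le> \<psi> x"
    and "v = scale_field \<psi> w" and "smooth_vector_field A v" and "flow_of_field A v \<Phi>"
    and "\<mu> = time_change_measure \<psi> \<nu>" and "ergodic_flow \<mu> \<Phi>"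
    and "L2_orthonormal_basis \<nu> z"
    and "\<forall>k. koopman_generator \<nu> \<Psi> (z k) (\<lambda>x. \<i> * of_real (\<omega> k) * z k x)"
    and "\<forall>k. smooth_fun A (z k)"
  shows "(\<forall>t. L2_bounded_operator \<mu> (mult_operator (\<psi> \<circ> \<Phi> t))) \<and>
         (\<forall>k t. has_L2_derivative \<mu> (\<lambda>s. koopman \<Phi> s (z k))
            (\<lambda>x. \<i> * of_real (\<omega> k) * mult_operator (\<psi> \<circ> \<Phi> t) (koopman \<Phi> t (z k)) x) t) \<and>
         (\<forall>k. AE a in \<mu>. \<forall>t.
            ((\<lambda>s. z k (\<Phi> s a)) has_vector_derivative
               \<i> * of_real (\<omega> k) * of_real (\<psi> (\<Phi> t a)) * z k (\<Phi> t a)) (at t) \<and>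
            z k (\<Phi> t a) =
              exp (\<i> * of_real (\<omega> k) * of_real (LBINT s=ereal 0..ereal t. \<psi> (\<Phi> s a))) * z k (\<Phi> 0 a))"
proof -
  note atlas = assms(1) and v = \<open>v = scale_field \<psi> w\<close>
  \<comment> \<open>Compactness of the manifold supplies the uniform bounds needed for dominated
    convergence and for the boundedness of the multiplication operators.\<close>
  have bdd: "\<exists>C. \<forall>x. norm (f x) \<le> C" if "continuous_on UNIV f" for f :: "'m \<Rightarrow> complex"
    using compact_imp_bounded[OF compact_continuous_image[OF that assms(3)]]
    by (auto simp: bounded_iff)
  have \<nu>: "prob_space \<nu>" "sets \<nu> = sets borel" "\<And>t. \<Psi> t \<in> measurable \<nu> \<nu>"
    using \<open>ergodic_flow \<nu> \<Psi>\<close> by (auto simp: ergodic_flow_def)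
  have \<mu>: "prob_space \<mu>" "sets \<mu> = sets borel" "\<And>t. \<Phi> t \<in> measurable \<mu> \<mu>"
    using \<open>ergodic_flow \<mu> \<Phi>\<close> by (auto simp: ergodic_flow_def)
  have fin: "finite_measure \<nu>" "finite_measure \<mu>"
    using \<nu>(1) \<mu>(1) by (auto simp: prob_space_def)
  have meas: "f \<in> borel_measurable \<nu>" "f \<in> borel_measurable \<mu>"
    if "continuous_on UNIV f" for f :: "'m \<Rightarrow> 'c::topological_space"
    using borel_measurable_continuous_onI[OF that] \<nu>(2) \<mu>(2) by (auto cong: measurable_cong_sets)
  have cont_z: "continuous_on UNIV (z k)" for k
    using assms(18) smooth_fun_continuous[OF atlas] by blast
  have cont_\<psi>: "continuous_on UNIV \<psi>"
    using assms(9) smooth_fun_continuous[OF atlas] by blast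
  obtain C\<psi> where "\<And>x. norm (of_real (\<psi> x) :: complex) \<le> C\<psi>"
    using bdd[of "\<lambda>x. of_real (\<psi> x)"] cont_\<psi> by (auto intro: continuous_on_of_real)
  then have C\<psi>: "\<bar>\<psi> x\<bar> \<le> C\<psi>" for x by simp
  \<comment> \<open>The eigenvalue equation is an identity of classes modulo null sets; here it
    becomes one between continuous functions at every point.\<close>
  have eigen: "Complex (w (\<lambda>x. Re (z k x)) x) (w (\<lambda>x. Im (z k x)) x) = \<i> * of_real (\<omega> k) * z k x"
    for k x
  proof -
    define W where "W x = Complex (w (\<lambda>x. Re (z k x)) x) (w (\<lambda>x. Im (z k x)) x)" for x
    define g where "g x = \<i> * of_real (\<omega> k) * z k x" for x
    have "smooth_fun A (\<lambda>x. Re (z k x))" "smooth_fun A (\<lambda>x. Im (z k x))"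
      using smooth_fun_bounded_linear[OF atlas bounded_linear_Re]
        smooth_fun_bounded_linear[OF atlas bounded_linear_Im] assms(18) by blast+
    then have "continuous_on UNIV (w (\<lambda>x. Re (z k x)))" "continuous_on UNIV (w (\<lambda>x. Im (z k x)))"
      using assms(5) by (auto simp: smooth_vector_field_def intro!: smooth_fun_continuous[OF atlas])
    then have cW: "continuous_on UNIV W"
      unfolding W_def Complex_eq by (intro continuous_intros)
    have cg: "continuous_on UNIV g"
      unfolding g_def by (intro continuous_intros cont_z)
    obtain C D where C: "\<And>x. norm (W x) \<le> C" and D: "\<And>x. norm (g x) \<le> D"
      using bdd[OF cW] bdd[OF cg] by blast
    have der: "((\<lambda>s. z k (\<Psi> s x)) has_vector_derivative W (\<Psi> t x)) (at t)" for x t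
      unfolding W_def using assms(6,18) by (intro flow_derivative_complex[OF atlas]) auto
    have id: "\<Psi> 0 x = x" for x
      using assms(6) by (simp add: flow_of_field_def smooth_flow_def)
    \<comment> \<open>The same quotients converge to the norm of \<open>W - g\<close> by dominated
      convergence and to 0 by the assumption on the generator.\<close>
    have "((\<lambda>h. L2_norm \<nu> (\<lambda>x. (z k (\<Psi> (0 + h) x) - z k (\<Psi> 0 x)) / of_real h - g x))
        \<longlongrightarrow> L2_norm \<nu> (\<lambda>x. W (\<Psi> 0 x) - g x)) (at 0)"
      by (rule L2_norm_difference_quotient_tendsto[OF fin(1) \<nu>(3) meas(1)[OF cont_z] meas(1)[OF cW] C
            meas(1)[OF cg] D der])
    moreover have "((\<lambda>h. L2_norm \<nu> (\<lambda>x. (z k (\<Psi> (0 + h) x) - z k (\<Psi> 0 x)) / of_real h - g x))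
        \<longlongrightarrow> 0) (at 0)"
      using assms(17) by (simp add: koopman_generator_def has_L2_derivative_def koopman_def g_def)
    ultimately have "L2_norm \<nu> (\<lambda>x. W (\<Psi> 0 x) - g x) = 0"
      using tendsto_unique[OF trivial_limit_at] by blast
    then have int0: "(\<integral>x. (norm (W x - g x))\<^sup>2 \<partial>\<nu>) = 0"
      by (simp add: L2_norm_def id)
    \<comment> \<open>Integrability has to be checked: the Bochner integral is 0 by default on
      functions that are not integrable, so \<open>int0\<close> alone would say nothing.\<close>
    have "(\<lambda>x. W x - g x) \<in> L2 \<nu>"
      by (rule L2_bounded[OF fin(1), where C="C + D"])
        (use C D meas(1)[OF cW] meas(1)[OF cg] in \<open>auto intro: order_trans[OF norm_triangle_ineq4] add_mono\<close>)
    then have "AE x in \<nu>. (norm (W x - g x))\<^sup>2 = 0"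
      using integral_nonneg_eq_0_iff_AE[of \<nu> "\<lambda>x. (norm (W x - g x))\<^sup>2"] int0 by (auto simp: L2_def)
    then have ae: "AE x in \<nu>. x \<notin> {x. W x \<noteq> g x}" by simp
    \<comment> \<open>By continuity the exceptional set is open; being null as well, it is
      empty.\<close>
    have op: "open {x. W x \<noteq> g x}"
      using cW cg by (rule open_Collect_neq)
    then have "{x. W x \<noteq> g x} \<in> sets \<nu>" by (simp add: \<nu>(2))
    then have "{x. W x \<noteq> g x} \<in> null_sets \<nu>"
      using ae AE_iff_null_sets by blast
    then have "emeasure \<nu> {x. W x \<noteq> g x} = 0" by (rule null_setsD1)
    with op have "{x. W x \<noteq> g x} = {}"
      by (intro smooth_positive_density_open_null[OF atlas assms(8)]) (auto simp: \<nu>(2))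
    then show ?thesis by (auto simp: W_def g_def)
  qed
  \<comment> \<open>Since \<open>v\<close> is \<psi> times \<open>w\<close>, multiplying
    \<open>eigen\<close> by \<psi> yields the oscillator equation along every orbit, without an
    exceptional set.\<close>
  have der: "((\<lambda>s. z k (\<Phi> s x)) has_vector_derivative
      \<i> * of_real (\<omega> k) * of_real (\<psi> (\<Phi> t x)) * z k (\<Phi> t x)) (at t)" for k x t
  proof -
    have "Complex (v (\<lambda>x. Re (z k x)) y) (v (\<lambda>x. Im (z k x)) y)
        = of_real (\<psi> y) * Complex (w (\<lambda>x. Re (z k x)) y) (w (\<lambda>x. Im (z k x)) y)" for y
      by (simp add: v scale_field_def complex_eq_iff)
    then show ?thesis
      using flow_derivative_complex[OF atlas assms(13), of "z k" x t] assms(18)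
      by (simp add: eigen mult_ac)
  qed
  \<comment> \<open>A global bound for \<psi> also bounds its composition with the flow, with one
    constant for all times.\<close>
  have "L2_bounded_operator \<mu> (mult_operator (\<psi> \<circ> \<Phi> t))" for t
    using measurable_comp[OF \<mu>(3) meas(2)[OF cont_\<psi>]] C\<psi>
    by (intro L2_bounded_operator_mult[where C=C\<psi>]) auto
  moreover have "has_L2_derivative \<mu> (\<lambda>s. koopman \<Phi> s (z k))
      (\<lambda>x. \<i> * of_real (\<omega> k) * mult_operator (\<psi> \<circ> \<Phi> t) (koopman \<Phi> t (z k)) x) t" for k t
  proof -
    define f' where "f' x = \<i> * of_real (\<omega> k) * of_real (\<psi> x) * z k x" for x
    have cf': "continuous_on UNIV f'"
      unfolding f'_def by (intro continuous_intros cont_z cont_\<psi>)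
    obtain C D where C: "\<And>x. norm (f' x) \<le> C" and D: "\<And>x. norm (z k x) \<le> D"
      using bdd[OF cf'] bdd[OF cont_z] by blast
    have f'\<Phi>: "(\<lambda>x. f' (\<Phi> t x)) \<in> borel_measurable \<mu>"
      using measurable_compose[OF \<mu>(3) meas(2)[OF cf']] .
    \<comment> \<open>With the comparison function equal to the derivative at time \<open>t\<close>,
      the limit is the norm of the zero function.\<close>
    have "((\<lambda>h. L2_norm \<mu> (\<lambda>x. (z k (\<Phi> (t + h) x) - z k (\<Phi> t x)) / of_real h - f' (\<Phi> t x)))
        \<longlongrightarrow> L2_norm \<mu> (\<lambda>x. f' (\<Phi> t x) - f' (\<Phi> t x))) (at 0)"
      by (rule L2_norm_difference_quotient_tendsto[OF fin(2) \<mu>(3) meas(2)[OF cont_z]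
            meas(2)[OF cf'] C f'\<Phi> C]) (simp add: f'_def der)
    moreover have "(\<lambda>x. z k (\<Phi> s x)) \<in> L2 \<mu>" for s
      by (rule L2_bounded[OF fin(2) measurable_compose[OF \<mu>(3) meas(2)[OF cont_z]] D])
    moreover have "(\<lambda>x. f' (\<Phi> t x)) \<in> L2 \<mu>"
      by (rule L2_bounded[OF fin(2) f'\<Phi> C])
    ultimately show ?thesis
      by (simp add: has_L2_derivative_def koopman_def mult_operator_def L2_norm_def f'_def o_def
          mult.assoc)
  qed
  moreover have "z k (\<Phi> t a) =
      exp (\<i> * of_real (\<omega> k) * of_real (LBINT s=ereal 0..ereal t. \<psi> (\<Phi> s a))) * z k (\<Phi> 0 a)" for k t a
  \<comment> \<open>Along the orbit of \<open>a\<close> the equation is scalar, with coefficient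
    \<open>\<psi> (\<Phi> s a)\<close>; its continuity in \<open>s\<close> comes from the joint
    continuity of the flow.\<close>
  proof (rule exponential_solution[OF _ der])
    have "continuous_on UNIV (\<lambda>(t, x). \<Phi> t x)"
      using assms(13) by (simp add: flow_of_field_def smooth_flow_def)
    moreover have "continuous_on UNIV (\<lambda>s. (s, a))"
      by (intro continuous_intros)
    ultimately have "continuous_on UNIV (\<lambda>s. \<Phi> s a)"
      using continuous_on_compose2[of UNIV "\<lambda>(t, x). \<Phi> t x" UNIV "\<lambda>s. (s, a)"] by simp
    from continuous_on_compose2[OF cont_\<psi> this]
    show "continuous_on UNIV (\<lambda>s. \<psi> (\<Phi> s a))" by simp
  qed
  \<comment> \<open>Both formulas in (ii) were shown for every starting point \<open>a\<close>,
    hence hold almost everywhere.\<close>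
  ultimately show ?thesis using der by blast
qed

end
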